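(* Let $f\colon\mathbb R\to\mathbb R$ be such that the composition operator $C_f$ maps $bv_1(\mathbb R)$ into itself. Then $C_f\colon bv_1(\mathbb R)\to bv_1(\mathbb R)$ is locally uniformly continuous if and only if $f$ is continuously differentiable on $\mathbb R$.
   Context: The composition operator $C_f$ assigns to a sequence $x\colon\mathbb N\to\mathbb R$ the sequence $C_f(x)$ with $C_f(x)(n)=f(x(n))$ for all $n\in\mathbb N$. $bv_1(\mathbb R)$ is the space of all sequences $x\colon\mathbb N\to\mathbb R$ with $\sum_{n=1}^\infty|x(n+1)-x(n)|<+\infty$, with norm $\|x\|_{bv_1}=|x(1)|+\sum_{n=1}^\infty|x(n+1)-x(n)|$. A map between normed spaces is called locally uniformly continuous if it is uniformly continuous on every bounded subset of its domain. *)

theory Defs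
  imports "HOL-Analysis.Analysis"
begin

text \<open>Sequences are indexed from 0, so the entry \<open>x 0\<close> plays the role of the first term \<open>x(1)\<close>.\<close>

definition bv1_seqs :: "(nat \<Rightarrow> real) set" where
  "bv1_seqs = {x. summable (\<lambda>n. \<bar>x (Suc n) - x n\<bar>)}"

lemma bv1_seqs_iff: "x \<in> bv1_seqs \<longleftrightarrow> summable (\<lambda>n. \<bar>x (Suc n) - x n\<bar>)"
  by (simp add: bv1_seqs_def)

lemma const_in_bv1_seqs: "(\<lambda>n. c) \<in> bv1_seqs"
  by (simp add: bv1_seqs_iff)

lemma add_in_bv1_seqs:
  assumes "x \<in> bv1_seqs" "y \<in> bv1_seqs"
  shows "(\<lambda>n. x n + y n) \<in> bv1_seqs"
  unfolding bv1_seqs_iff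
proof (rule summable_comparison_test')
  show "summable (\<lambda>n. \<bar>x (Suc n) - x n\<bar> + \<bar>y (Suc n) - y n\<bar>)"
    using assms by (intro summable_add) (simp_all add: bv1_seqs_iff)
qed auto

lemma scale_in_bv1_seqs:
  assumes "x \<in> bv1_seqs"
  shows "(\<lambda>n. c * x n) \<in> bv1_seqs"
proof -
  have "(\<lambda>n. \<bar>c * x (Suc n) - c * x n\<bar>) = (\<lambda>n. \<bar>c\<bar> * \<bar>x (Suc n) - x n\<bar>)"
    by (simp add: abs_mult flip: right_diff_distrib)
  then show ?thesis
    using assms by (simp add: bv1_seqs_iff summable_mult)
qed

typedef bv1 = bv1_seqs
  morphisms seq_of Abs_bv1
  using const_in_bv1_seqs by blast

setup_lifting type_definition_bv1

lemma summable_seq_of: "summable (\<lambda>n. \<bar>seq_of x (Suc n) - seq_of x n\<bar>)"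
  using seq_of[of x] by (simp add: bv1_seqs_iff)

lemma bv1_eqI: "(\<And>n. seq_of x n = seq_of y n) \<Longrightarrow> x = y"
  by (metis ext seq_of_inject)

instantiation bv1 :: real_vector
begin

lift_definition zero_bv1 :: bv1 is "\<lambda>n. 0"
  by (rule const_in_bv1_seqs)

lift_definition plus_bv1 :: "bv1 \<Rightarrow> bv1 \<Rightarrow> bv1" is "\<lambda>x y n. x n + y n"
  by (rule add_in_bv1_seqs)

lift_definition uminus_bv1 :: "bv1 \<Rightarrow> bv1" is "\<lambda>x n. - x n"
  using scale_in_bv1_seqs[where c = "-1"] by simp

lift_definition minus_bv1 :: "bv1 \<Rightarrow> bv1 \<Rightarrow> bv1" is "\<lambda>x y n. x n - y n"
  using add_in_bv1_seqs scale_in_bv1_seqs[where c = "-1"] by fastforce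

lift_definition scaleR_bv1 :: "real \<Rightarrow> bv1 \<Rightarrow> bv1" is "\<lambda>c x n. c * x n"
  by (rule scale_in_bv1_seqs)

instance
  by standard (transfer, simp add: algebra_simps fun_eq_iff)+

end

lemma seq_of_simps [simp]:
  "seq_of 0 n = 0"
  "seq_of (x + y) n = seq_of x n + seq_of y n"
  "seq_of (- x) n = - seq_of x n"
  "seq_of (x - y) n = seq_of x n - seq_of y n"
  "seq_of (c *\<^sub>R x) n = c * seq_of x n"
  by (transfer; simp)+

instantiation bv1 :: real_normed_vector
begin

definition norm_bv1 :: "bv1 \<Rightarrow> real" where
  "norm_bv1 x = \<bar>seq_of x 0\<bar> + (\<Sum>n. \<bar>seq_of x (Suc n) - seq_of x n\<bar>)"

definition dist_bv1 :: "bv1 \<Rightarrow> bv1 \<Rightarrow> real" where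
  "dist_bv1 x y = norm (x - y)"

definition sgn_bv1 :: "bv1 \<Rightarrow> bv1" where
  "sgn_bv1 x = inverse (norm x) *\<^sub>R x"

definition uniformity_bv1 :: "(bv1 \<times> bv1) filter" where
  "uniformity_bv1 = (INF e\<in>{0<..}. principal {(x, y). dist x y < e})"

definition open_bv1 :: "bv1 set \<Rightarrow> bool" where
  "open_bv1 U = (\<forall>x\<in>U. eventually (\<lambda>(x', y). x' = x \<longrightarrow> y \<in> U) uniformity)"

instance
proof
  fix x y :: bv1 and a :: real
  show "dist x y = norm (x - y)"
    by (rule dist_bv1_def)
  show "sgn x = inverse (norm x) *\<^sub>R x"
    by (rule sgn_bv1_def)
  show "uniformity = (INF e\<in>{0<..}. principal {(x, y :: bv1). dist x y < e})"
    by (rule uniformity_bv1_def)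
  show "open U = (\<forall>x\<in>U. eventually (\<lambda>(x', y). x' = x \<longrightarrow> y \<in> U) uniformity)" for U :: "bv1 set"
    by (rule open_bv1_def)
  show "norm x = 0 \<longleftrightarrow> x = 0"
  proof
    assume n0: "norm x = 0"
    have "0 \<le> (\<Sum>n. \<bar>seq_of x (Suc n) - seq_of x n\<bar>)"
      by (rule suminf_nonneg[OF summable_seq_of]) simp
    with n0 have "seq_of x 0 = 0" and s0: "(\<Sum>n. \<bar>seq_of x (Suc n) - seq_of x n\<bar>) = 0"
      unfolding norm_bv1_def by linarith+
    from s0 have "seq_of x (Suc n) = seq_of x n" for n
      using suminf_eq_zero_iff[OF summable_seq_of[of x]] by simp
    with \<open>seq_of x 0 = 0\<close> have "seq_of x n = 0" for n
      by (induction n) simp_all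
    then show "x = 0"
      by (intro bv1_eqI) simp
  qed (simp add: norm_bv1_def)
  show "norm (x + y) \<le> norm x + norm y"
  proof -
    have "(\<Sum>n. \<bar>seq_of (x + y) (Suc n) - seq_of (x + y) n\<bar>)
        \<le> (\<Sum>n. \<bar>seq_of x (Suc n) - seq_of x n\<bar> + \<bar>seq_of y (Suc n) - seq_of y n\<bar>)"
      by (intro suminf_le summable_seq_of summable_add) simp
    also have "\<dots> = (\<Sum>n. \<bar>seq_of x (Suc n) - seq_of x n\<bar>) + (\<Sum>n. \<bar>seq_of y (Suc n) - seq_of y n\<bar>)"
      by (intro suminf_add[symmetric] summable_seq_of)
    finally show ?thesis
      unfolding norm_bv1_def using abs_triangle_ineq[of "seq_of x 0" "seq_of y 0"] by simp
  qed
  show "norm (a *\<^sub>R x) = \<bar>a\<bar> * norm x"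
  proof -
    have "(\<Sum>n. \<bar>seq_of (a *\<^sub>R x) (Suc n) - seq_of (a *\<^sub>R x) n\<bar>)
        = (\<Sum>n. \<bar>a\<bar> * \<bar>seq_of x (Suc n) - seq_of x n\<bar>)"
      by (simp add: abs_mult flip: right_diff_distrib)
    also have "\<dots> = \<bar>a\<bar> * (\<Sum>n. \<bar>seq_of x (Suc n) - seq_of x n\<bar>)"
      by (rule suminf_mult[OF summable_seq_of])
    finally show ?thesis
      by (simp add: norm_bv1_def abs_mult distrib_left)
  qed
qed

end

definition comp_op :: "(real \<Rightarrow> real) \<Rightarrow> (nat \<Rightarrow> real) \<Rightarrow> (nat \<Rightarrow> real)" where
  "comp_op f x = (\<lambda>n. f (x n))"

text \<open>The composition operator as a self-map of the normed space \<open>bv1\<close>; meaningful only when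
  \<open>comp_op f\<close> maps \<open>bv1_seqs\<close> into itself, since \<open>Abs_bv1\<close> is unspecified elsewhere.\<close>

definition comp_op_bv1 :: "(real \<Rightarrow> real) \<Rightarrow> bv1 \<Rightarrow> bv1" where
  "comp_op_bv1 f x = Abs_bv1 (comp_op f (seq_of x))"

lemma seq_of_comp_op_bv1:
  assumes "\<forall>x\<in>bv1_seqs. comp_op f x \<in> bv1_seqs"
  shows "seq_of (comp_op_bv1 f x) = comp_op f (seq_of x)"
  using assms seq_of[of x] by (simp add: comp_op_bv1_def Abs_bv1_inverse)

definition locally_uniformly_continuous ::
    "('a::real_normed_vector \<Rightarrow> 'b::real_normed_vector) \<Rightarrow> bool" where
  "locally_uniformly_continuous F \<longleftrightarrow> (\<forall>S. bounded S \<longrightarrow> uniformly_continuous_on S F)"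

end

theory Submission
  imports Defs
begin

text \<open>
  If \<open>f\<close> is \<open>C\<^sup>1\<close>, the mean value theorem applied to the difference
  \<open>t \<mapsto> f (a + t (b - a)) - f (c + t (d - c))\<close> bounds each increment of \<open>C\<^sub>f x - C\<^sub>f y\<close> by the
  oscillation of \<open>f'\<close> times the increment of \<open>x\<close>, plus \<open>sup \<bar>f'\<bar>\<close> times the increment of
  \<open>x - y\<close>.

  Conversely, a sequence jumping about \<open>1 / \<bar>h\<bar>\<close> times between \<open>u\<close> and \<open>u + h\<close> has bounded norm, and
  its translate by \<open>v - u\<close> is at distance \<open>\<bar>u - v\<bar>\<close> from it, whatever \<open>h\<close> is. Uniform continuity
  therefore makes the difference quotients \<open>q\<^sub>h\<close> of \<open>f\<close> equicontinuous, uniformly in \<open>h\<close>. If \<open>F\<close> is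
  an antiderivative of \<open>f\<close>, the second difference \<open>F (u + h + k) - F (u + h) - F (u + k) + F u\<close>
  equals both \<open>h k q\<^sub>k s\<close> and \<open>h k q\<^sub>h s'\<close> for some \<open>s\<close>, \<open>s'\<close> near \<open>u\<close>, so the quotients
  \<open>q\<^sub>h u\<close> are Cauchy as \<open>h\<close> tends to 0, and their limit is continuous in \<open>u\<close>.
\<close>

section \<open>Mean value estimates for increments\<close>

lemma mvt_increment:
  fixes G g :: "real \<Rightarrow> real"
  assumes "\<And>x. \<bar>x - u\<bar> \<le> \<bar>h\<bar> \<Longrightarrow> (G has_real_derivative g x) (at x)"
  shows "\<exists>s. \<bar>s - u\<bar> \<le> \<bar>h\<bar> \<and> G (u + h) - G u = h * g s"
proof -
  consider "h = 0" | "h > 0" | "h < 0" by linarith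
  then show ?thesis
  proof cases
    case 1
    then show ?thesis by auto
  next
    case 2
    then have "\<exists>z. u < z \<and> z < u + h \<and> G (u + h) - G u = (u + h - u) * g z"
      by (intro MVT2 assms) auto
    then obtain z where "u < z" "z < u + h" "G (u + h) - G u = (u + h - u) * g z"
      by blast
    then show ?thesis using 2 by (intro exI[of _ z]) auto
  next
    case 3
    then have "\<exists>z. u + h < z \<and> z < u \<and> G u - G (u + h) = (u - (u + h)) * g z"
      by (intro MVT2 assms) auto
    then obtain z where "u + h < z" "z < u" "G u - G (u + h) = (u - (u + h)) * g z"
      by blast
    then show ?thesis using 3 by (intro exI[of _ z]) (auto simp: algebra_simps)
  qed
qed

text \<open>Treating both increments as one function of \<open>t\<close> yields a common parameter
  \<open>t\<close> from the mean value theorem. The intermediate points then divide their segments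
  in the same ratio, so they are as close as the end points are.\<close>

lemma increment_difference_bound:
  fixes f f' :: "real \<Rightarrow> real"
  assumes deriv: "\<And>x. (f has_real_derivative f' x) (at x)"
    and bound: "\<And>v. \<bar>v\<bar> \<le> R \<Longrightarrow> \<bar>f' v\<bar> \<le> M"
    and osc: "\<And>u v. \<bar>u\<bar> \<le> R \<Longrightarrow> \<bar>v\<bar> \<le> R \<Longrightarrow> \<bar>u - v\<bar> \<le> r \<Longrightarrow> \<bar>f' u - f' v\<bar> \<le> e"
    and R: "\<bar>a\<bar> \<le> R" "\<bar>b\<bar> \<le> R" "\<bar>c\<bar> \<le> R" "\<bar>d\<bar> \<le> R"
    and r: "\<bar>a - c\<bar> \<le> r" "\<bar>b - d\<bar> \<le> r"
  shows "\<bar>(f b - f a) - (f d - f c)\<bar> \<le> e * \<bar>b - a\<bar> + M * \<bar>(b - a) - (d - c)\<bar>"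
proof -
  let ?\<phi> = "\<lambda>t. f (a + t * (b - a)) - f (c + t * (d - c))"
  let ?\<phi>' = "\<lambda>t. f' (a + t * (b - a)) * (b - a) - f' (c + t * (d - c)) * (d - c)"
  have "(?\<phi> has_real_derivative ?\<phi>' t) (at t)" for t
    by (rule derivative_eq_intros DERIV_chain'[OF _ deriv] refl | simp)+
  then have "\<exists>t>0. t < 1 \<and> ?\<phi> 1 - ?\<phi> 0 = (1 - 0) * ?\<phi>' t"
    by (intro MVT2) auto
  then obtain t where t: "0 < t" "t < 1" and eq: "?\<phi> 1 - ?\<phi> 0 = ?\<phi>' t"
    by auto
  have convex: "\<bar>p + t * (q - p)\<bar> \<le> s" if "\<bar>p\<bar> \<le> s" "\<bar>q\<bar> \<le> s" for p q s :: real
  proof -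
    have "\<bar>(1 - t) * p + t * q\<bar> \<le> (1 - t) * \<bar>p\<bar> + t * \<bar>q\<bar>"
      using t abs_triangle_ineq[of "(1 - t) * p" "t * q"] by (simp add: abs_mult)
    also have "\<dots> \<le> s"
      using t that by (intro convex_bound_le) auto
    finally show ?thesis by (simp add: algebra_simps)
  qed
  define u v where "u = a + t * (b - a)" and "v = c + t * (d - c)"
  have "\<bar>u\<bar> \<le> R" "\<bar>v\<bar> \<le> R"
    unfolding u_def v_def using R by (auto intro: convex)
  \<comment> \<open>The difference \<open>u - v\<close> is the convex combination of
    \<open>a - c\<close> and \<open>b - d\<close> with the same weight \<open>t\<close>.\<close>
  moreover have "\<bar>u - v\<bar> \<le> r"
    using convex[OF r] by (simp add: u_def v_def algebra_simps)
  ultimately have "\<bar>f' u - f' v\<bar> * \<bar>b - a\<bar> \<le> e * \<bar>b - a\<bar>"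
    "\<bar>f' v\<bar> * \<bar>(b - a) - (d - c)\<bar> \<le> M * \<bar>(b - a) - (d - c)\<bar>"
    by (auto intro!: mult_right_mono osc bound)
  moreover have "(f b - f a) - (f d - f c) = (f' u - f' v) * (b - a) + f' v * ((b - a) - (d - c))"
    using eq by (simp add: u_def v_def algebra_simps)
  ultimately show ?thesis
    using abs_triangle_ineq[of "(f' u - f' v) * (b - a)" "f' v * ((b - a) - (d - c))"]
    by (simp add: abs_mult)
qed

section \<open>Sufficiency of continuous differentiability\<close>

lemma norm_bv1_ge_sum:
  "\<bar>seq_of x 0\<bar> + (\<Sum>n<N. \<bar>seq_of x (Suc n) - seq_of x n\<bar>) \<le> norm x"
  unfolding norm_bv1_def using sum_le_suminf[OF summable_seq_of, of "{..<N}" x] by simp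

lemma abs_seq_of_le_norm: "\<bar>seq_of x n\<bar> \<le> norm x"
proof -
  have "\<bar>seq_of x n\<bar> \<le> \<bar>seq_of x 0\<bar> + (\<Sum>i<n. \<bar>seq_of x (Suc i) - seq_of x i\<bar>)"
    by (induction n) auto
  then show ?thesis using norm_bv1_ge_sum[of x n] by linarith
qed

text \<open>Entries are bounded by the norm, so on a bounded set they all lie in one compact
  interval, where \<open>f'\<close> is bounded and uniformly continuous. The increment estimate is
  then summed over all indices.\<close>

lemma C1_imp_locally_uniformly_continuous_comp_op:
  assumes self: "\<forall>x\<in>bv1_seqs. comp_op f x \<in> bv1_seqs"
    and deriv: "\<And>x. (f has_real_derivative f' x) (at x)"
    and cont: "continuous_on UNIV f'"
  shows "locally_uniformly_continuous (comp_op_bv1 f)"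
  unfolding locally_uniformly_continuous_def
proof (intro allI impI)
  fix S :: "bv1 set"
  assume "bounded S"
  then obtain R where R: "R > 0" "\<And>x. x \<in> S \<Longrightarrow> norm x \<le> R"
    by (auto simp: bounded_pos)
  have contR: "continuous_on {-R..R} f'"
    using cont continuous_on_subset by blast
  then have "bounded (f' ` {-R..R})"
    by (intro compact_imp_bounded compact_continuous_image) auto
  then obtain M where M: "M > 0" "\<And>v. \<bar>v\<bar> \<le> R \<Longrightarrow> \<bar>f' v\<bar> \<le> M"
    by (auto simp: bounded_pos abs_le_iff)
  have uc: "uniformly_continuous_on {-R..R} f'"
    using contR by (intro compact_uniformly_continuous) auto
  show "uniformly_continuous_on S (comp_op_bv1 f)"
    unfolding uniformly_continuous_on_def
  proof (intro allI impI)
    fix e :: real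
    assume e: "e > 0"
    \<comment> \<open>The error budget is \<open>e' * R = e / 2\<close> for the oscillation of
      \<open>f'\<close>, and less than \<open>e / 4\<close> each for the initial entry and for the
      \<open>M\<close>-part of the variation.\<close>
    define e' where "e' = e / (2 * R)"
    have "e' > 0" using e R by (simp add: e'_def)
    with uc obtain r where r: "r > 0"
      "\<And>u v. u \<in> {-R..R} \<Longrightarrow> v \<in> {-R..R} \<Longrightarrow> dist v u < r \<Longrightarrow> dist (f' v) (f' u) < e'"
      unfolding uniformly_continuous_on_def by meson
    define \<delta> where "\<delta> = min r (e / (4 * M))"
    have "norm (comp_op_bv1 f x - comp_op_bv1 f y) < e"
      if xy: "x \<in> S" "y \<in> S" "norm (x - y) < \<delta>" for x y
    proof -
      let ?X = "seq_of x" and ?Y = "seq_of y" and ?Z = "comp_op_bv1 f x - comp_op_bv1 f y"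
      have inR: "\<bar>?X n\<bar> \<le> R" "\<bar>?Y n\<bar> \<le> R" for n
        using abs_seq_of_le_norm R(2) xy by (meson order_trans)+
      have osc: "\<bar>f' u - f' v\<bar> \<le> e'"
        if "\<bar>u\<bar> \<le> R" "\<bar>v\<bar> \<le> R" "\<bar>u - v\<bar> \<le> norm (x - y)" for u v
      proof -
        have "dist u v < r" "u \<in> {-R..R}" "v \<in> {-R..R}"
          using that xy(3) by (auto simp: dist_real_def \<delta>_def)
        then show ?thesis using r(2)[of v u] by (simp add: dist_real_def)
      qed
      have close: "\<bar>?X n - ?Y n\<bar> \<le> norm (x - y)" for n
        using abs_seq_of_le_norm[of "x - y" n] by simp
      have Z: "seq_of ?Z n = f (?X n) - f (?Y n)" for n
        by (simp add: seq_of_comp_op_bv1[OF self] comp_op_def)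
      have step: "\<bar>seq_of ?Z (Suc n) - seq_of ?Z n\<bar>
          \<le> e' * \<bar>?X (Suc n) - ?X n\<bar> + M * \<bar>seq_of (x - y) (Suc n) - seq_of (x - y) n\<bar>" for n
      proof -
        \<comment> \<open>The norm takes increments of a difference, the increment estimate takes
          differences of increments; \<open>swap\<close> regroups one into the other.\<close>
        have swap: "p - q - (r - s) = p - r - (q - s)" for p q r s :: real by simp
        show ?thesis
          unfolding Z unfolding seq_of_simps swap[of _ "f (?Y (Suc n))"] swap[of _ "?Y (Suc n)"]
          by (rule increment_difference_bound[OF deriv M(2) osc inR(1) inR(1) inR(2) inR(2)
                close close])
      qed
      have "(\<Sum>n. \<bar>seq_of ?Z (Suc n) - seq_of ?Z n\<bar>)
          \<le> (\<Sum>n. e' * \<bar>?X (Suc n) - ?X n\<bar> + M * \<bar>seq_of (x - y) (Suc n) - seq_of (x - y) n\<bar>)"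
        by (intro suminf_le step summable_seq_of summable_add summable_mult)
      also have "\<dots> = e' * (\<Sum>n. \<bar>?X (Suc n) - ?X n\<bar>)
          + M * (\<Sum>n. \<bar>seq_of (x - y) (Suc n) - seq_of (x - y) n\<bar>)"
        using suminf_add[OF summable_mult[OF summable_seq_of] summable_mult[OF summable_seq_of]]
          suminf_mult[OF summable_seq_of] by metis
      also have "\<dots> \<le> e' * R + M * norm (x - y)"
        using \<open>e' > 0\<close> M(1) R(2)[OF xy(1)]
        by (intro add_mono mult_left_mono) (auto simp: norm_bv1_def)
      finally have tail: "(\<Sum>n. \<bar>seq_of ?Z (Suc n) - seq_of ?Z n\<bar>) \<le> e' * R + M * norm (x - y)" .
      have "\<bar>seq_of ?Z 0\<bar> \<le> M * norm (x - y)"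
      proof -
        have "\<bar>f (?X 0) - f (?Y 0)\<bar> \<le> M * \<bar>?X 0 - ?Y 0\<bar>"
          using field_differentiable_bound[of "{-R..R}" f f' M "?X 0" "?Y 0"] inR[of 0] M(2)
            has_field_derivative_at_within[OF deriv]
          by (auto simp: abs_le_iff)
        also have "\<dots> \<le> M * norm (x - y)"
          using close M(1) by (intro mult_left_mono) auto
        finally show ?thesis by (simp only: Z)
      qed
      moreover have "M * norm (x - y) < e / 4"
        using xy(3) M(1) by (simp add: \<delta>_def field_simps)
      moreover have "e' * R = e / 2"
        using R(1) by (simp add: e'_def)
      ultimately show ?thesis
        using tail by (simp add: norm_bv1_def[of ?Z])
    qed
    moreover have "\<delta> > 0" using e r(1) M(1) by (simp add: \<delta>_def)
    ultimately show "\<exists>d>0. \<forall>x\<in>S. \<forall>x'\<in>S. dist x' x < d \<longrightarrow>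
        dist (comp_op_bv1 f x') (comp_op_bv1 f x) < e"
      by (auto simp: dist_norm)
  qed
qed

section \<open>Zigzag sequences and equicontinuity of difference quotients\<close>

text \<open>The \<open>min\<close> freezes the sequence after \<open>N\<close> jumps, which keeps
  its variation finite.\<close>

definition zigzag :: "real \<Rightarrow> real \<Rightarrow> nat \<Rightarrow> nat \<Rightarrow> real" where
  "zigzag u h N n = (if even (min n N) then u else u + h)"

lemma zigzag_0 [simp]: "zigzag u h N 0 = u"
  by (simp add: zigzag_def)

lemma zigzag_in_bv1_seqs: "zigzag u h N \<in> bv1_seqs"
  unfolding bv1_seqs_iff
  by (rule summable_finite[of "{..<N}"]) (auto simp: zigzag_def)

lemma seq_of_Abs_zigzag [simp]: "seq_of (Abs_bv1 (zigzag u h N)) = zigzag u h N"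
  by (simp add: Abs_bv1_inverse zigzag_in_bv1_seqs)

lemma norm_zigzag: "norm (Abs_bv1 (zigzag u h N)) = \<bar>u\<bar> + real N * \<bar>h\<bar>"
proof -
  have "(\<Sum>n. \<bar>zigzag u h N (Suc n) - zigzag u h N n\<bar>)
      = (\<Sum>n<N. \<bar>zigzag u h N (Suc n) - zigzag u h N n\<bar>)"
    by (rule suminf_finite) (auto simp: zigzag_def)
  also have "\<dots> = (\<Sum>n<N. \<bar>h\<bar>)"
    by (rule sum.cong) (auto simp: zigzag_def min_def)
  finally show ?thesis by (simp add: norm_bv1_def)
qed

text \<open>Equal jumps cancel, so the difference is a constant sequence and only the initial entry
  counts.\<close>

lemma norm_diff_zigzag: "norm (Abs_bv1 (zigzag u h N) - Abs_bv1 (zigzag v h N)) = \<bar>u - v\<bar>"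
proof -
  have "\<bar>zigzag u h N (Suc n) - zigzag v h N (Suc n) - (zigzag u h N n - zigzag v h N n)\<bar> = 0" for n
    by (simp add: zigzag_def)
  then show ?thesis by (simp add: norm_bv1_def)
qed

text \<open>Upward and downward jumps contribute the same quantity with opposite signs, so the
  absolute values add up over all \<open>N\<close> jumps.\<close>

lemma norm_comp_op_diff_zigzag_ge:
  assumes "\<forall>x\<in>bv1_seqs. comp_op f x \<in> bv1_seqs"
  shows "\<bar>f u - f v\<bar> + real N * \<bar>f (u + h) - f u - (f (v + h) - f v)\<bar>
    \<le> norm (comp_op_bv1 f (Abs_bv1 (zigzag u h N)) - comp_op_bv1 f (Abs_bv1 (zigzag v h N)))"
    (is "_ \<le> norm ?Z")
proof -
  have Z: "seq_of ?Z n = f (zigzag u h N n) - f (zigzag v h N n)" for n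
    by (simp add: seq_of_comp_op_bv1[OF assms] comp_op_def)
  have "(\<Sum>n<N. \<bar>seq_of ?Z (Suc n) - seq_of ?Z n\<bar>)
      = (\<Sum>n<N. \<bar>f (u + h) - f u - (f (v + h) - f v)\<bar>)"
    unfolding Z by (rule sum.cong) (auto simp: zigzag_def min_def)
  then show ?thesis
    using norm_bv1_ge_sum[of ?Z N] Z[of 0] by simp
qed

lemma locally_uniformly_continuous_comp_op_imp_equicontinuous:
  assumes self: "\<forall>x\<in>bv1_seqs. comp_op f x \<in> bv1_seqs"
    and luc: "locally_uniformly_continuous (comp_op_bv1 f)"
    and e: "e > 0"
  shows "\<exists>d>0. \<forall>v. \<bar>v - u\<bar> < d \<longrightarrow> \<bar>f v - f u\<bar> < e \<and>
    (\<forall>h. h \<noteq> 0 \<longrightarrow> \<bar>h\<bar> \<le> 1 \<longrightarrow> \<bar>f (v + h) - f v - (f (u + h) - f u)\<bar> \<le> e * \<bar>h\<bar>)"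
proof -
  \<comment> \<open>Radius: \<bar>v\<bar> is at most \<bar>u\<bar> + 1, and the variation of the
    zigzag is at most 1.\<close>
  define S :: "bv1 set" where "S = cball 0 (\<bar>u\<bar> + 2)"
  have "uniformly_continuous_on S (comp_op_bv1 f)"
    using luc by (simp add: locally_uniformly_continuous_def S_def)
  moreover have "e / 2 > 0" using e by simp
  ultimately obtain d where d: "d > 0"
    "\<And>x y. x \<in> S \<Longrightarrow> y \<in> S \<Longrightarrow> dist y x < d \<Longrightarrow> dist (comp_op_bv1 f y) (comp_op_bv1 f x) < e / 2"
    unfolding uniformly_continuous_on_def by meson
  have main: "\<bar>f v - f u\<bar> + real N * \<bar>f (v + h) - f v - (f (u + h) - f u)\<bar> < e / 2"
    if "\<bar>v - u\<bar> < min d 1" "real N * \<bar>h\<bar> \<le> 1" for v h N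
  proof -
    have "Abs_bv1 (zigzag u h N) \<in> S" "Abs_bv1 (zigzag v h N) \<in> S"
      using that by (auto simp: S_def norm_zigzag)
    then show ?thesis
      using d(2) that norm_comp_op_diff_zigzag_ge[OF self, of v u N h]
      by (fastforce simp: dist_norm norm_diff_zigzag)
  qed
  have "\<bar>f (v + h) - f v - (f (u + h) - f u)\<bar> \<le> e * \<bar>h\<bar>"
    if v: "\<bar>v - u\<bar> < min d 1" and h: "h \<noteq> 0" "\<bar>h\<bar> \<le> 1" for v h
  proof -
    \<comment> \<open>As many jumps as variation 1 allows. Since \<open>1 / \<bar>h\<bar>\<close> is
      at least 1, rounding down loses at most a factor 2, which the bound \<open>e / 2\<close> in
      \<open>main\<close> absorbs.\<close>
    define N where "N = nat \<lfloor>1 / \<bar>h\<bar>\<rfloor>"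
    let ?D = "\<bar>f (v + h) - f v - (f (u + h) - f u)\<bar>"
    have inv: "1 / \<bar>h\<bar> \<ge> 1" using h by simp
    then have "1 \<le> \<lfloor>1 / \<bar>h\<bar>\<rfloor>" by (simp only: one_le_floor)
    then have N: "real N = of_int \<lfloor>1 / \<bar>h\<bar>\<rfloor>" by (simp add: N_def)
    then have N1: "real N \<ge> 1" "real N \<le> 1 / \<bar>h\<bar>" and "1 / \<bar>h\<bar> < real N + 1"
      using \<open>1 \<le> \<lfloor>1 / \<bar>h\<bar>\<rfloor>\<close> by linarith+
    then have "1 / \<bar>h\<bar> \<le> 2 * real N" by linarith
    then have "?D * (1 / \<bar>h\<bar>) \<le> ?D * (2 * real N)"
      by (intro mult_left_mono) auto
    also have "\<dots> \<le> e"
    proof -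
      have "real N * \<bar>h\<bar> \<le> 1" using N1(2) h by (simp add: field_simps)
      then have "\<bar>f v - f u\<bar> + real N * ?D < e / 2" by (rule main[OF v])
      then have "real N * ?D < e / 2"
        by (rule le_less_trans[rotated]) simp
      then show ?thesis by (simp add: mult_ac)
    qed
    finally show ?thesis using h by (simp add: field_simps)
  qed
  \<comment> \<open>With no jumps, \<open>main\<close> compares constant sequences.\<close>
  moreover have "\<bar>f v - f u\<bar> < e" if "\<bar>v - u\<bar> < min d 1" for v
    using main[OF that, of 0 0] e by simp
  moreover have "min d 1 > 0" using d(1) by simp
  ultimately show ?thesis by blast
qed

section \<open>From equicontinuous difference quotients to a continuous derivative\<close>

lemma equicontinuous_difference_quotients_imp_C1:
  fixes f :: "real \<Rightarrow> real"
  assumes cont: "continuous_on UNIV f"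
    and equi: "\<And>u e. e > 0 \<Longrightarrow> \<exists>d>0. \<forall>v h. \<bar>v - u\<bar> < d \<longrightarrow> h \<noteq> 0 \<longrightarrow> \<bar>h\<bar> \<le> 1 \<longrightarrow>
      \<bar>f (v + h) - f v - (f (u + h) - f u)\<bar> \<le> e * \<bar>h\<bar>"
  shows "f C1_differentiable_on UNIV"
proof -
  define q where "q = (\<lambda>h u. (f (u + h) - f u) / h)"
  have equi_q: "\<exists>d>0. d \<le> 1 \<and>
      (\<forall>v h. \<bar>v - u\<bar> < d \<longrightarrow> h \<noteq> 0 \<longrightarrow> \<bar>h\<bar> \<le> 1 \<longrightarrow> \<bar>q h v - q h u\<bar> \<le> e)"
    if e: "e > 0" for u e
  proof -
    obtain d where d: "d > 0" "\<And>v h. \<bar>v - u\<bar> < d \<Longrightarrow> h \<noteq> 0 \<Longrightarrow> \<bar>h\<bar> \<le> 1 \<Longrightarrow>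
        \<bar>f (v + h) - f v - (f (u + h) - f u)\<bar> \<le> e * \<bar>h\<bar>"
      using equi[OF e, of u] by blast
    have "\<bar>q h v - q h u\<bar> \<le> e" if "\<bar>v - u\<bar> < d" "h \<noteq> 0" "\<bar>h\<bar> \<le> 1" for v h
    proof -
      have "q h v - q h u = (f (v + h) - f v - (f (u + h) - f u)) / h"
        by (simp add: q_def diff_divide_distrib)
      then show ?thesis
        using d(2)[OF that] that(2) by (simp add: abs_divide pos_divide_le_eq)
    qed
    then show ?thesis using d(1) by (intro exI[of _ "min d 1"]) auto
  qed
  have cauchy: "\<exists>d>0. \<forall>h k. h \<noteq> 0 \<longrightarrow> k \<noteq> 0 \<longrightarrow> \<bar>h\<bar> < d \<longrightarrow> \<bar>k\<bar> < d \<longrightarrow> \<bar>q h u - q k u\<bar> \<le> e"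
    if e: "e > 0" for u e
  proof -
    obtain d where d: "d > 0" "d \<le> 1"
      "\<And>v h. \<bar>v - u\<bar> < d \<Longrightarrow> h \<noteq> 0 \<Longrightarrow> \<bar>h\<bar> \<le> 1 \<Longrightarrow> \<bar>q h v - q h u\<bar> \<le> e / 2"
      using equi_q[of "e / 2" u] e by auto
    \<comment> \<open>Differentiability of \<open>f\<close> is still to be shown, so the mean value
      theorem is applied to an antiderivative. Radius 3 leaves room, as all arguments used stay
      within distance 2 of \<open>u\<close>.\<close>
    obtain F where F: "\<And>x. x \<in> {u - 3..u + 3} \<Longrightarrow>
        (F has_vector_derivative f x) (at x within {u - 3..u + 3})"
      using antiderivative_continuous[of "u - 3" "u + 3" f] cont continuous_on_subset by blast
    have F': "(F has_real_derivative f x) (at x)" if "\<bar>x - u\<bar> < 3" for x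
    proof -
      have "x \<in> interior {u - 3..u + 3}" using that by (simp add: abs_less_iff)
      then show ?thesis
        using F[of x] that at_within_interior[of x "{u - 3..u + 3}"]
        by (auto simp: has_real_derivative_iff_has_vector_derivative abs_less_iff)
    qed
    have second_difference: "\<exists>s. \<bar>s - u\<bar> \<le> \<bar>h\<bar> \<and>
        F (u + h + k) - F (u + h) - (F (u + k) - F u) = h * k * q k s"
      if hk: "k \<noteq> 0" "\<bar>h\<bar> < d" "\<bar>k\<bar> < d" for h k
    proof -
      let ?G = "\<lambda>x. F (x + k) - F x"
      have "(?G has_real_derivative (f (x + k) - f x)) (at x)" if "\<bar>x - u\<bar> \<le> \<bar>h\<bar>" for x
      proof (intro DERIV_diff F')
        show "((\<lambda>x. F (x + k)) has_real_derivative f (x + k)) (at x)"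
          unfolding DERIV_shift[symmetric] using that hk d(2) by (intro F') linarith
      qed (use that hk d(2) in linarith)
      from mvt_increment[of u h ?G, OF this] obtain s where
        "\<bar>s - u\<bar> \<le> \<bar>h\<bar>" "?G (u + h) - ?G u = h * (f (s + k) - f s)"
        by blast
      then show ?thesis
        using hk(1) by (intro exI[of _ s]) (simp add: q_def)
    qed
    have "\<bar>q h u - q k u\<bar> \<le> e" if hk: "h \<noteq> 0" "k \<noteq> 0" "\<bar>h\<bar> < d" "\<bar>k\<bar> < d" for h k
    proof -
      obtain s where s: "\<bar>s - u\<bar> \<le> \<bar>h\<bar>"
        "F (u + h + k) - F (u + h) - (F (u + k) - F u) = h * k * q k s"
        using second_difference[of k h] hk by auto
      obtain s' where s': "\<bar>s' - u\<bar> \<le> \<bar>k\<bar>"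
        "F (u + k + h) - F (u + k) - (F (u + h) - F u) = k * h * q h s'"
        using second_difference[of h k] hk by auto
      \<comment> \<open>The second difference is symmetric in \<open>h\<close> and \<open>k\<close>,
        so its two evaluations agree and \<open>h * k\<close> cancels.\<close>
      have "u + k + h = u + h + k" by simp
      then have "h * k * q k s = h * k * q h s'"
        using s(2) s'(2) mult.commute[of k h] by (simp only:)
      then have "q k s = q h s'" using hk by simp
      moreover have "\<bar>q k s - q k u\<bar> \<le> e / 2" "\<bar>q h s' - q h u\<bar> \<le> e / 2"
        using s(1) s'(1) hk d by (auto intro!: d(3))
      ultimately show ?thesis by linarith
    qed
    then show ?thesis using d(1) by blast
  qed
  \<comment> \<open>A null sequence in (0, 1] supplies the candidate limit \<open>D\<close>; the
    bound 1 keeps every \<open>t n\<close> admissible in \<open>equi_q\<close>.\<close>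
  define t :: "nat \<Rightarrow> real" where "t = (\<lambda>n. inverse (real (Suc n)))"
  have t: "t n > 0" for n by (simp add: t_def)
  have t_small: "\<exists>N. \<forall>n\<ge>N. \<bar>t n\<bar> < d" if "d > 0" for d
    using LIMSEQ_inverse_real_of_nat that unfolding t_def LIMSEQ_iff by force
  have "Cauchy (\<lambda>n. q (t n) u)" for u
  proof (rule CauchyI)
    fix e :: real
    assume "e > 0"
    then obtain d where d: "d > 0"
      "\<And>h k. h \<noteq> 0 \<Longrightarrow> k \<noteq> 0 \<Longrightarrow> \<bar>h\<bar> < d \<Longrightarrow> \<bar>k\<bar> < d \<Longrightarrow> \<bar>q h u - q k u\<bar> \<le> e / 2"
      using cauchy[of "e / 2" u] by auto
    obtain N where "\<forall>n\<ge>N. \<bar>t n\<bar> < d" using t_small[OF d(1)] by blast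
    then have "\<bar>q (t m) u - q (t n) u\<bar> \<le> e / 2" if "m \<ge> N" "n \<ge> N" for m n
      using that t[of m] t[of n] by (intro d(2)) auto
    then show "\<exists>M. \<forall>m\<ge>M. \<forall>n\<ge>M. norm (q (t m) u - q (t n) u) < e"
      using \<open>e > 0\<close> by (fastforce intro!: exI[of _ N])
  qed
  then have "\<exists>D. \<forall>u. (\<lambda>n. q (t n) u) \<longlonglongrightarrow> D u"
    by (intro choice allI) (simp add: Cauchy_convergent_iff convergent_def)
  then obtain D where D: "\<And>u. (\<lambda>n. q (t n) u) \<longlonglongrightarrow> D u" by blast
  have deriv: "(f has_real_derivative D u) (at u)" for u
    unfolding DERIV_def LIM_eq
  proof (intro allI impI)
    fix e :: real
    assume e: "e > 0"
    then obtain d where d: "d > 0"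
      "\<And>h k. h \<noteq> 0 \<Longrightarrow> k \<noteq> 0 \<Longrightarrow> \<bar>h\<bar> < d \<Longrightarrow> \<bar>k\<bar> < d \<Longrightarrow> \<bar>q h u - q k u\<bar> \<le> e / 2"
      using cauchy[of "e / 2" u] by auto
    obtain N where N: "\<forall>n\<ge>N. \<bar>t n\<bar> < d" using t_small[OF d(1)] by blast
    have "norm ((f (u + h) - f u) / h - D u) < e" if h: "h \<noteq> 0" "norm (h - 0) < d" for h
    proof -
      \<comment> \<open>With \<open>h\<close> fixed, letting \<open>n\<close> tend to infinity turns
        the Cauchy estimate into convergence of the full quotient; \<open>e / 2\<close> makes the
        final bound strict.\<close>
      have "(\<lambda>n. \<bar>q h u - q (t n) u\<bar>) \<longlonglongrightarrow> \<bar>q h u - D u\<bar>"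
        by (intro tendsto_intros D)
      moreover have "\<bar>q h u - q (t n) u\<bar> \<le> e / 2" if "n \<ge> N" for n
        using that N h t[of n] by (intro d(2)) auto
      ultimately have "\<bar>q h u - D u\<bar> \<le> e / 2"
        by (intro LIMSEQ_le_const2) auto
      then show ?thesis using e by (simp add: q_def)
    qed
    then show "\<exists>s>0. \<forall>h. h \<noteq> 0 \<and> norm (h - 0) < s \<longrightarrow> norm ((f (u + h) - f u) / h - D u) < e"
      using d(1) by blast
  qed
  moreover have "continuous_on UNIV D"
    unfolding continuous_on_iff
  proof (intro ballI allI impI)
    fix u e :: real
    assume e: "e > 0"
    then obtain d where d: "d > 0"
      "\<And>v h. \<bar>v - u\<bar> < d \<Longrightarrow> h \<noteq> 0 \<Longrightarrow> \<bar>h\<bar> \<le> 1 \<Longrightarrow> \<bar>q h v - q h u\<bar> \<le> e / 2"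
      using equi_q[of "e / 2" u] by auto
    have "dist (D v) (D u) < e" if v: "dist v u < d" for v
    proof -
      \<comment> \<open>Here \<open>d\<close> does not depend on the step \<open>t n\<close>, so
        equicontinuity survives the limit.\<close>
      have "(\<lambda>n. \<bar>q (t n) v - q (t n) u\<bar>) \<longlonglongrightarrow> \<bar>D v - D u\<bar>"
        by (intro tendsto_intros D)
      moreover have "\<bar>q (t n) v - q (t n) u\<bar> \<le> e / 2" for n
        using v by (intro d(2)) (auto simp: dist_real_def t_def field_simps)
      ultimately have "\<bar>D v - D u\<bar> \<le> e / 2"
        by (intro LIMSEQ_le_const2) auto
      then show ?thesis using e by (simp add: dist_real_def)
    qed
    then show "\<exists>d>0. \<forall>v\<in>UNIV. dist v u < d \<longrightarrow> dist (D v) (D u) < e"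
      using d(1) by blast
  qed
  ultimately show ?thesis
    unfolding C1_differentiable_on_def has_real_derivative_iff_has_vector_derivative by blast
qed

theorem theorem22:
  fixes f :: "real \<Rightarrow> real"
  assumes "\<forall>x\<in>bv1_seqs. comp_op f x \<in> bv1_seqs"
  shows "locally_uniformly_continuous (comp_op_bv1 f) \<longleftrightarrow> f C1_differentiable_on UNIV"
proof
  assume "locally_uniformly_continuous (comp_op_bv1 f)"
  note equi = locally_uniformly_continuous_comp_op_imp_equicontinuous[OF assms this]
  show "f C1_differentiable_on UNIV"
  proof (rule equicontinuous_difference_quotients_imp_C1)
    show "continuous_on UNIV f"
      unfolding continuous_on_iff dist_real_def using equi by blast
  qed (use equi in blast)
next
  assume "f C1_differentiable_on UNIV"
  then obtain f' where "\<And>x. (f has_real_derivative f' x) (at x)" "continuous_on UNIV f'"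
    by (auto simp: C1_differentiable_on_def has_real_derivative_iff_has_vector_derivative)
  then show "locally_uniformly_continuous (comp_op_bv1 f)"
    by (rule C1_imp_locally_uniformly_continuous_comp_op[OF assms])
qed

end
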